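(* Let $\mathbf{a},\mathbf{b}\in{\rm SL}(3,\mathbb{C})$ be such that the pair $(\mathbf{a},\mathbf{b})$ is irreducible. Then there exists $\mathbf{c}\in{\rm SL}(3,\mathbb{C})$ such that $\mathbf{c}\mathbf{a}\mathbf{c}^{-1}$ and $\mathbf{c}\mathbf{b}\mathbf{c}^{-1}$ are both symmetric matrices if and only if ${\rm tr}(\mathbf{a}\mathbf{b}\mathbf{a}^{-1}\mathbf{b}^{-1})={\rm tr}(\mathbf{b}\mathbf{a}\mathbf{b}^{-1}\mathbf{a}^{-1})$.
   Context: A pair $(\mathbf{a},\mathbf{b})$ of elements of ${\rm SL}(3,\mathbb{C})$ is called irreducible if the representation of the free group $F_2=\langle z_1,z_2\rangle$ on $\mathbb{C}^3$ sending $z_1\mapsto\mathbf{a}$, $z_2\mapsto\mathbf{b}$ is irreducible; equivalently, $\mathbf{a},\mathbf{b}$ have no common eigenvector and their transposes $\mathbf{a}^{\rm tr},\mathbf{b}^{\rm tr}$ have no common eigenvector. *)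

theory Defs
  imports "HOL-Analysis.Analysis" "HOL-Algebra.Group"
begin

section \<open>The free group on two generators\<close>

datatype gen = Z1 | Z2

(* (z, True) stands for the generator z and (z, False) for its inverse. *)
type_synonym letter = "gen \<times> bool"

definition inv_letter :: "letter \<Rightarrow> letter" where
  "inv_letter x = (fst x, \<not> snd x)"

definition reduced_word :: "letter list \<Rightarrow> bool" where
  "reduced_word w \<longleftrightarrow> (\<forall>i. Suc i < length w \<longrightarrow> w ! i \<noteq> inv_letter (w ! Suc i))"

(* Left multiplication of a reduced word by one letter, followed by cancellation. *)
definition push :: "letter \<Rightarrow> letter list \<Rightarrow> letter list" where
  "push x w = (case w of [] \<Rightarrow> [x] | y # ys \<Rightarrow> if x = inv_letter y then ys else x # w)"

definition F2 :: "letter list monoid" where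
  "F2 = \<lparr>carrier = {w. reduced_word w}, mult = (\<lambda>u v. foldr push u v), one = []\<rparr>"

definition z1 :: "letter list" where "z1 = [(Z1, True)]"
definition z2 :: "letter list" where "z2 = [(Z2, True)]"

lemma inv_letter_inv [simp]: "inv_letter (inv_letter x) = x"
  by (simp add: inv_letter_def)

lemma inv_letter_neq [simp]: "inv_letter x \<noteq> x" "x \<noteq> inv_letter x"
  by (cases x; simp add: inv_letter_def)+

lemma inv_letter_inject [simp]: "inv_letter x = inv_letter y \<longleftrightarrow> x = y"
  by (metis inv_letter_inv)

lemma reduced_Nil [simp]: "reduced_word []"
  and reduced_single [simp]: "reduced_word [x]"
  by (simp_all add: reduced_word_def)

lemma reduced_Cons_Cons [simp]:
  "reduced_word (x # y # w) \<longleftrightarrow> x \<noteq> inv_letter y \<and> reduced_word (y # w)"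
proof
  assume L: "reduced_word (x # y # w)"
  have "x \<noteq> inv_letter y"
    using L[unfolded reduced_word_def, rule_format, of 0] by simp
  moreover have "reduced_word (y # w)"
    unfolding reduced_word_def
  proof (intro allI impI)
    fix i assume "Suc i < length (y # w)"
    then show "(y # w) ! i \<noteq> inv_letter ((y # w) ! Suc i)"
      using L[unfolded reduced_word_def, rule_format, of "Suc i"] by simp
  qed
  ultimately show "x \<noteq> inv_letter y \<and> reduced_word (y # w)" ..
next
  assume R: "x \<noteq> inv_letter y \<and> reduced_word (y # w)"
  show "reduced_word (x # y # w)"
    unfolding reduced_word_def
  proof (intro allI impI)
    fix i assume "Suc i < length (x # y # w)"
    then show "(x # y # w) ! i \<noteq> inv_letter ((x # y # w) ! Suc i)"
      using R by (cases i) (auto simp: reduced_word_def)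
  qed
qed

lemma reduced_tl: "reduced_word (x # w) \<Longrightarrow> reduced_word w"
  by (cases w) auto

lemma reduced_push: "reduced_word w \<Longrightarrow> reduced_word (push x w)"
  by (cases w) (auto simp: push_def dest: reduced_tl)

lemma reduced_foldr_push: "reduced_word v \<Longrightarrow> reduced_word (foldr push u v)"
  by (induction u) (auto intro: reduced_push)

lemma push_cancel: "reduced_word w \<Longrightarrow> push x (push (inv_letter x) w) = w"
  by (cases w rule: list.exhaust; cases "tl w")
    (auto simp: push_def split: if_splits)

lemma push_cancel': "reduced_word w \<Longrightarrow> push (inv_letter x) (push x w) = w"
  using push_cancel[of w "inv_letter x"] by simp

lemma foldr_push_push:
  "reduced_word w \<Longrightarrow> foldr push (push x u) w = push x (foldr push u w)"
  by (cases u) (auto simp: push_def[of x "_ # _"] push_def[of x "[]"] push_cancel'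
      push_cancel reduced_foldr_push)

lemma foldr_push_assoc:
  "reduced_word w \<Longrightarrow> foldr push (foldr push u v) w = foldr push u (foldr push v w)"
  by (induction u) (auto simp: foldr_push_push)

lemma foldr_push_Nil: "reduced_word u \<Longrightarrow> foldr push u [] = u"
proof (induction u)
  case (Cons x u)
  then show ?case by (cases u) (auto simp: push_def)
qed simp

lemma foldr_push_inv:
  "reduced_word w \<Longrightarrow> foldr push (rev (map inv_letter u)) (foldr push u w) = w"
proof (induction u arbitrary: w)
  case (Cons x u)
  then show ?case
    by (simp add: push_cancel' reduced_foldr_push)
qed simp

lemma group_F2: "group F2"
proof (rule groupI)
  fix u assume u: "u \<in> carrier F2"
  define v where "v = foldr push (rev (map inv_letter u)) []"
  have "v \<in> carrier F2"
    by (simp add: v_def F2_def reduced_foldr_push)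
  moreover have "v \<otimes>\<^bsub>F2\<^esub> u = \<one>\<^bsub>F2\<^esub>"
  proof -
    have "foldr push v u = foldr push (rev (map inv_letter u)) (foldr push u [])"
      using u by (simp add: v_def foldr_push_assoc F2_def foldr_push_Nil)
    then show ?thesis by (simp add: foldr_push_inv F2_def)
  qed
  ultimately show "\<exists>v\<in>carrier F2. v \<otimes>\<^bsub>F2\<^esub> u = \<one>\<^bsub>F2\<^esub>" by blast
qed (auto simp: F2_def reduced_foldr_push foldr_push_assoc)


section \<open>Representations\<close>

definition SL :: "('a::comm_ring_1 ^ 'n ^ 'n) set" where
  "SL = {A. det A = 1}"

definition GL :: "('a::field ^ 'n ^ 'n) monoid" where
  "GL = \<lparr>carrier = {A. invertible A}, mult = (**), one = mat 1\<rparr>"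

(* The space is nonzero because index types are nonempty.  Subspaces are taken over the
   field 'a: for 'a = complex the plain constant subspace would mean real subspaces. *)
definition irreducible_rep ::
    "('g, 'm) monoid_scheme \<Rightarrow> ('g \<Rightarrow> 'a::field ^ 'n ^ 'n) \<Rightarrow> bool" where
  "irreducible_rep G \<rho> \<longleftrightarrow> \<rho> \<in> hom G GL \<and>
     (\<forall>V. vec.subspace V \<and> (\<forall>g\<in>carrier G. \<forall>v\<in>V. \<rho> g *v v \<in> V) \<longrightarrow> V = {0} \<or> V = UNIV)"

fun eval_letter :: "'a::field ^ 'n ^ 'n \<Rightarrow> 'a ^ 'n ^ 'n \<Rightarrow> letter \<Rightarrow> 'a ^ 'n ^ 'n" where
  "eval_letter a b (Z1, s) = (if s then a else matrix_inv a)"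
| "eval_letter a b (Z2, s) = (if s then b else matrix_inv b)"

definition F2_rep :: "'a::field ^ 'n ^ 'n \<Rightarrow> 'a ^ 'n ^ 'n \<Rightarrow> letter list \<Rightarrow> 'a ^ 'n ^ 'n" where
  "F2_rep a b w = foldr (\<lambda>x M. eval_letter a b x ** M) w (mat 1)"

definition irreducible_pair :: "'a::field ^ 'n ^ 'n \<Rightarrow> 'a ^ 'n ^ 'n \<Rightarrow> bool" where
  "irreducible_pair a b \<longleftrightarrow> irreducible_rep F2 (F2_rep a b)"

lemma F2_rep_z1: "F2_rep a b z1 = a"
  and F2_rep_z2: "F2_rep a b z2 = b"
  by (simp_all add: F2_rep_def z1_def z2_def)

lemma matrix_inv_cancel:
  fixes a :: "'a::field ^ 'n ^ 'n"
  assumes "invertible a"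
  shows "a ** matrix_inv a = mat 1" "matrix_inv a ** a = mat 1"
proof -
  have "a ** matrix_inv a = mat 1 \<and> matrix_inv a ** a = mat 1"
    unfolding matrix_inv_def by (rule someI_ex) (use assms in \<open>simp add: invertible_def\<close>)
  then show "a ** matrix_inv a = mat 1" "matrix_inv a ** a = mat 1" by auto
qed

lemma eval_letter_inv:
  assumes "invertible a" "invertible b"
  shows "eval_letter a b (inv_letter x) ** eval_letter a b x = mat 1"
proof -
  obtain g s where "x = (g, s)" by force
  then show ?thesis
    using assms by (cases g) (auto simp: inv_letter_def matrix_inv_cancel)
qed

lemma invertible_eval_letter:
  assumes "invertible a" "invertible b"
  shows "invertible (eval_letter a b x)"
  using eval_letter_inv[OF assms, of x] eval_letter_inv[OF assms, of "inv_letter x"]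
  unfolding invertible_def by auto

lemma F2_rep_push:
  assumes "invertible a" "invertible b"
  shows "F2_rep a b (push x w) = eval_letter a b x ** F2_rep a b w"
  using eval_letter_inv[OF assms]
  by (cases w) (auto simp: push_def F2_rep_def matrix_mul_assoc)

lemma F2_rep_hom:
  assumes "invertible a" "invertible b"
  shows "F2_rep a b \<in> hom F2 GL"
proof (rule homI)
  have one: "invertible (mat 1 :: 'a ^ 'n ^ 'n)"
    unfolding invertible_def by (intro exI[of _ "mat 1"]) simp
  fix u :: "letter list"
  show "F2_rep a b u \<in> carrier GL"
    by (induction u)
      (auto simp: F2_rep_def GL_def one invertible_eval_letter[OF assms] intro!: invertible_mult)
next
  fix u v :: "letter list"
  show "F2_rep a b (u \<otimes>\<^bsub>F2\<^esub> v) = F2_rep a b u \<otimes>\<^bsub>GL\<^esub> F2_rep a b v"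
  proof (induction u)
    case Nil
    then show ?case by (simp add: F2_def GL_def F2_rep_def)
  next
    case (Cons x u)
    then show ?case
      by (simp add: F2_def GL_def F2_rep_push[OF assms] matrix_mul_assoc)
        (simp add: F2_rep_def matrix_mul_assoc)
  qed
qed

lemma F2_rep_unique:
  assumes "invertible a" "invertible b"
    and hom: "\<rho> \<in> hom F2 GL" and gens: "\<rho> z1 = a" "\<rho> z2 = b" and "w \<in> carrier F2"
  shows "\<rho> w = F2_rep a b w"
proof -
  have nil: "[] \<in> carrier F2" and single: "[x] \<in> carrier F2" for x
    by (simp_all add: F2_def)
  have mult: "\<rho> (foldr push u v) = \<rho> u ** \<rho> v" if "u \<in> carrier F2" "v \<in> carrier F2" for u v
    using hom_mult[OF hom that] by (simp add: F2_def GL_def)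
  have inv_rho: "invertible (\<rho> u)" if "u \<in> carrier F2" for u
    using hom_in_carrier[OF hom that] by (simp add: GL_def)
  have rho_Nil: "\<rho> [] = mat 1"
  proof -
    have "\<rho> [] = \<rho> [] ** \<rho> []" using mult[OF nil nil] by simp
    then have "matrix_inv (\<rho> []) ** \<rho> [] = matrix_inv (\<rho> []) ** (\<rho> [] ** \<rho> [])" by simp
    then show ?thesis by (simp add: matrix_mul_assoc matrix_inv_cancel[OF inv_rho[OF nil]])
  qed
  have rho_inv: "\<rho> [(g, False)] = matrix_inv (\<rho> [(g, True)])" for g
  proof -
    have "\<rho> [(g, False)] ** \<rho> [(g, True)] = mat 1"
      using mult[OF single single, of "(g, False)" "(g, True)"]
      by (simp add: push_def inv_letter_def rho_Nil)
    then have "\<rho> [(g, False)] ** (\<rho> [(g, True)] ** matrix_inv (\<rho> [(g, True)])) =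
        matrix_inv (\<rho> [(g, True)])"
      by (simp add: matrix_mul_assoc)
    then show ?thesis by (simp add: matrix_inv_cancel[OF inv_rho[OF single]])
  qed
  have letter: "\<rho> [x] = eval_letter a b x" for x
  proof -
    obtain g s where "x = (g, s)" by force
    then show ?thesis
      using gens by (cases g; cases s) (auto simp: rho_inv z1_def z2_def)
  qed
  from \<open>w \<in> carrier F2\<close> show ?thesis
  proof (induction w)
    case Nil
    then show ?case by (simp add: rho_Nil F2_rep_def)
  next
    case (Cons x w)
    then have red: "reduced_word (x # w)" and w: "w \<in> carrier F2"
      by (auto simp: F2_def dest: reduced_tl)
    have "push x w = x # w"
      using red by (cases w) (auto simp: push_def)
    then have "\<rho> (x # w) = \<rho> [x] ** \<rho> w"
      using mult[OF single w, of x] by simp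
    then show ?case
      using Cons.IH[OF w] by (simp add: letter F2_rep_def)
  qed
qed

end

theory Submission
  imports Defs "HOL-Computational_Algebra.Fundamental_Theorem_Algebra"
begin

text \<open>
  If \<open>c\<close> makes both matrices symmetric, then \<open>G = c\<^sup>T c\<close> is symmetric and so are \<open>G a\<close> and \<open>G b\<close>.
  Conversely, a nonzero symmetric \<open>G\<close> with \<open>G a\<close> and \<open>G b\<close> symmetric has a kernel invariant
  under \<open>a\<close> and \<open>b\<close>, so it is invertible by irreducibility; over the complex numbers it factors as
  \<open>c\<^sup>T c\<close>, and \<open>c\<close> symmetrizes the pair.  The conditions on \<open>G\<close> are six linear equations in
  the six entries of a symmetric matrix, and the determinant of that system is a polynomial of bidegree
  \<open>(3, 3)\<close> in \<open>(a, b)\<close> which is, up to a constant, the difference of the two commutator traces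
  (inverses being replaced by adjugates).  Rather than expanding a \<open>6 \<times> 6\<close> determinant, one
  takes an eigenvector \<open>v\<close> of \<open>a\<close> and works in the basis \<open>v, b v, b\<^sup>2 v\<close> or, if \<open>b\<^sup>2 v\<close>
  lies in the plane of \<open>v\<close> and \<open>b v\<close>, in the basis \<open>v, b v, a b v\<close>.  Solving the easy
  equations leaves a \<open>3 \<times> 3\<close>, respectively \<open>2 \<times> 2\<close>, system with that determinant.
\<close>

section \<open>Matrices of size three\<close>

text \<open>Replaces the inverse on \<open>SL\<close>, so that the commutator traces become
  polynomials in the entries and can be compared with determinants by polynomial identities.\<close>

definition adjugate3 :: "'a::comm_ring_1 ^ 3 ^ 3 \<Rightarrow> 'a ^ 3 ^ 3" where
  "adjugate3 A = vector [
     vector [A$2$2 * A$3$3 - A$2$3 * A$3$2, A$1$3 * A$3$2 - A$1$2 * A$3$3, A$1$2 * A$2$3 - A$1$3 * A$2$2],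
     vector [A$2$3 * A$3$1 - A$2$1 * A$3$3, A$1$1 * A$3$3 - A$1$3 * A$3$1, A$1$3 * A$2$1 - A$1$1 * A$2$3],
     vector [A$2$1 * A$3$2 - A$2$2 * A$3$1, A$1$2 * A$3$1 - A$1$1 * A$3$2, A$1$1 * A$2$2 - A$1$2 * A$2$1]]"

lemma mult_adjugate3: "A ** adjugate3 A = mat (det A)"
  by (simp add: vec_eq_iff matrix_matrix_mult_def forall_3 sum_3 adjugate3_def mat_def det_3
      algebra_simps)

lemma matrix_inv_eqI:
  fixes A :: "'a::field ^ 'n ^ 'n"
  assumes "A ** B = mat 1"
  shows "matrix_inv A = B"
proof -
  have "invertible A"
    using assms invertible_right_inverse by blast
  then have "matrix_inv A ** A = mat 1"
    by (rule matrix_inv_cancel)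
  then show ?thesis
    using assms by (metis matrix_mul_assoc matrix_mul_lid matrix_mul_rid)
qed

lemma matrix_inv_SL3:
  fixes A :: "'a::field ^ 3 ^ 3"
  assumes "A \<in> SL"
  shows "matrix_inv A = adjugate3 A"
  using assms by (intro matrix_inv_eqI) (simp add: mult_adjugate3 SL_def)

lemma singular_kernel:
  fixes A :: "'a::field ^ 'n ^ 'n"
  assumes "det A = 0"
  obtains x where "x \<noteq> 0" "A *v x = 0"
  using assms invertible_det_nz[of A] invertible_left_inverse[of A] matrix_left_invertible_ker[of A]
  by blast

lemma eigenvector3_exists:
  fixes A :: "complex ^ 3 ^ 3"
  obtains l v where "v \<noteq> 0" "A *v v = l *s v"
proof -
  \<comment> \<open>The characteristic polynomial, constant term first: determinant, minus the sum
    of the principal minors of size two, trace, \<open>-1\<close>.\<close>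
  define p where "p = [: det A,
     A$1$2 * A$2$1 + A$1$3 * A$3$1 + A$2$3 * A$3$2 - A$1$1 * A$2$2 - A$1$1 * A$3$3 - A$2$2 * A$3$3,
     A$1$1 + A$2$2 + A$3$3, -1 :]"
  have p: "poly p z = det (A - mat z)" for z
    by (simp add: p_def det_3 mat_def algebra_simps power3_eq_cube power2_eq_square)
  have "\<exists>z. poly p z = 0"
    by (rule fundamental_theorem_of_algebra_alt) (simp add: p_def)
  then obtain z where "det (A - mat z) = 0"
    using p by auto
  then obtain v where "v \<noteq> 0" "(A - mat z) *v v = 0"
    by (rule singular_kernel)
  moreover have "mat z *v v = z *s v"
    by (simp add: vec_eq_iff matrix_vector_mult_def mat_def if_distrib if_distribR cong: if_cong)
  ultimately show ?thesis
    by (intro that[of v z]) (simp_all add: matrix_vector_mult_diff_rdistrib)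
qed

section \<open>Orthonormal bases for complex symmetric forms\<close>

text \<open>Bilinear rather than Hermitian: there is no conjugation, so nonzero isotropic vectors
  can occur over the complex numbers.\<close>

definition bilin :: "'a::field ^ 'n ^ 'n \<Rightarrow> 'a ^ 'n \<Rightarrow> 'a ^ 'n \<Rightarrow> 'a" where
  "bilin G x y = (\<Sum>i\<in>UNIV. x$i * (G *v y)$i)"

lemma bilin_zero [simp]: "bilin G 0 y = 0" "bilin G x 0 = 0"
  by (simp_all add: bilin_def)

lemma bilin_add: "bilin G (x + x') y = bilin G x y + bilin G x' y"
  "bilin G x (y + y') = bilin G x y + bilin G x y'"
  by (simp_all add: bilin_def matrix_vector_right_distrib algebra_simps sum.distrib)

lemma bilin_scale: "bilin G (k *s x) y = k * bilin G x y" "bilin G x (k *s y) = k * bilin G x y"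
  by (simp_all add: bilin_def vector_scalar_commute sum_distrib_left algebra_simps)

lemma bilin_diff:
  fixes x :: "'a::field ^ 'n"
  shows "bilin G x (y - y') = bilin G x y - bilin G x y'"
  by (simp add: bilin_def matrix_vector_mult_diff_distrib algebra_simps sum_subtractf)

lemma bilin_sum: "bilin G x (\<Sum>i\<in>I. y i) = (\<Sum>i\<in>I. bilin G x (y i))"
  by (induction I rule: infinite_finite_induct) (simp_all add: bilin_add)

lemma bilin_eq_sum: "bilin G x y = (\<Sum>i\<in>UNIV. \<Sum>j\<in>UNIV. x$i * G$i$j * y$j)"
  by (simp add: bilin_def matrix_vector_mult_def sum_distrib_left mult.assoc)

lemma bilin_commute:
  assumes "transpose G = G"
  shows "bilin G x y = bilin G y x"
proof -
  have "G$i$j = G$j$i" for i j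
    using assms by (metis transpose_def vec_lambda_beta)
  then show ?thesis
    unfolding bilin_eq_sum by (subst sum.swap) (simp add: mult_ac)
qed

lemma bilin_columns: "(transpose P ** G ** P)$i$j = bilin G (column i P) (column j P)"
  by (simp add: bilin_eq_sum matrix_matrix_mult_def transpose_def column_def sum_distrib_right)
    (rule sum.swap)

lemma bilin_nondegenerate:
  assumes "\<And>x. bilin G x y = 0"
  shows "G *v y = 0"
proof -
  have "bilin G (axis i 1) y = (G *v y)$i" for i
    by (simp add: bilin_def axis_def if_distrib if_distribR cong: if_cong)
  then show ?thesis
    using assms by (simp add: vec_eq_iff)
qed

text \<open>A Gram-Schmidt step. An index outside \<open>S\<close> leaves room for a nonzero vector
  orthogonal to all \<open>v i\<close>; as it may be isotropic, a non-isotropic one must first be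
  found in the orthogonal complement.\<close>

lemma orthonormal_extend:
  fixes G :: "complex ^ 'n ^ 'n" and v :: "'n \<Rightarrow> complex ^ 'n"
  assumes sym: "transpose G = G" and inv: "invertible G"
    and S: "\<And>i j. i \<in> S \<Longrightarrow> j \<in> S \<Longrightarrow> bilin G (v i) (v j) = (if i = j then 1 else 0)"
    and k: "k \<notin> S"
  shows "\<exists>w. bilin G w w = 1 \<and> (\<forall>i\<in>S. bilin G (v i) w = 0)"
proof -
  \<comment> \<open>Row \<open>k\<close> of \<open>N\<close> vanishes, so \<open>N\<close> has a nonzero kernel vector, orthogonal to all \<open>v i\<close>.\<close>
  define N where "N = (\<chi> i. if i \<in> S then v i v* G else 0)"
  have N: "(N *v w)$i = (if i \<in> S then bilin G (v i) w else 0)" for w i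
    unfolding bilin_eq_sum
    by (subst sum.swap) (simp add: N_def matrix_vector_mult_def vector_matrix_mult_def
        sum_distrib_left sum_distrib_right mult_ac)
  have "row k N = 0"
    using k by (simp add: N_def row_def vec_eq_iff)
  then have "det N = 0"
    by (rule det_zero_row(2))
  then obtain w where w: "w \<noteq> 0" "N *v w = 0"
    by (rule singular_kernel)
  have w_perp: "bilin G (v i) w = 0" if "i \<in> S" for i
    using N[of w i] w(2) that by simp
  \<comment> \<open>If the orthogonal complement were isotropic, polarization would put \<open>w\<close> in the radical of \<open>G\<close>.\<close>
  have "\<exists>w. bilin G w w \<noteq> 0 \<and> (\<forall>i\<in>S. bilin G (v i) w = 0)"
  proof (rule ccontr)
    assume "\<not> ?thesis"
    then have iso: "bilin G x x = 0" if "\<And>i. i \<in> S \<Longrightarrow> bilin G (v i) x = 0" for x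
      using that by blast
    have "bilin G u w = 0" for u
    proof -
      \<comment> \<open>The component of \<open>u\<close> orthogonal to all \<open>v i\<close>, to
        which \<open>iso\<close> applies.\<close>
      define u' where "u' = u - (\<Sum>i\<in>S. bilin G (v i) u *s v i)"
      have u': "bilin G (v i) u' = 0" if "i \<in> S" for i
        using that by (simp add: u'_def bilin_diff bilin_sum bilin_scale S if_distrib cong: if_cong)
      have "bilin G (u' + w) (u' + w) = 0" "bilin G u' u' = 0" "bilin G w w = 0"
        by (rule iso; simp add: bilin_add u' w_perp)+
      then have "bilin G w u' = 0"
        by (simp add: bilin_add bilin_commute[OF sym, of u' w])
      moreover have "u = u' + (\<Sum>i\<in>S. bilin G (v i) u *s v i)"
        by (simp add: u'_def)
      moreover have "bilin G w (\<Sum>i\<in>S. bilin G (v i) u *s v i) = 0"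
        by (simp add: bilin_sum bilin_scale bilin_commute[OF sym, of w] w_perp)
      ultimately have "bilin G w u = 0"
        by (metis bilin_add(2) add_0)
      then show ?thesis
        by (simp add: bilin_commute[OF sym, of u])
    qed
    then have "G *v w = 0"
      by (rule bilin_nondegenerate)
    then show False
      using w(1) inv invertible_left_inverse matrix_left_invertible_ker by blast
  qed
  then obtain w' where w': "bilin G w' w' \<noteq> 0" "\<And>i. i \<in> S \<Longrightarrow> bilin G (v i) w' = 0"
    by blast
  \<comment> \<open>A complex square root of the nonzero value at \<open>w'\<close> allows rescaling
    to value 1.\<close>
  define s where "s = csqrt (bilin G w' w')"
  have s: "bilin G w' w' = s * s" "s \<noteq> 0"
    using w'(1) by (simp_all add: s_def flip: power2_eq_square)
  have "bilin G (inverse s *s w') (inverse s *s w') = 1"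
    using s(2) by (simp add: bilin_scale s(1) field_simps)
  then show ?thesis
    using w'(2) by (intro exI[of _ "inverse s *s w'"]) (simp add: bilin_scale)
qed

lemma orthonormal_basis_exists:
  fixes G :: "complex ^ 'n ^ 'n"
  assumes sym: "transpose G = G" and inv: "invertible G"
  obtains P :: "complex ^ 'n ^ 'n" where "transpose P ** G ** P = mat 1"
proof -
  have "\<exists>v. \<forall>i\<in>S. \<forall>j\<in>S. bilin G (v i) (v j) = (if i = j then 1 else 0)" for S :: "'n set"
  proof (induction S rule: infinite_finite_induct)
    case (insert k S)
    then obtain v where v: "\<And>i j. i \<in> S \<Longrightarrow> j \<in> S \<Longrightarrow> bilin G (v i) (v j) = (if i = j then 1 else 0)"
      by blast
    then have "\<exists>w. bilin G w w = 1 \<and> (\<forall>i\<in>S. bilin G (v i) w = 0)"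
      by (rule orthonormal_extend[OF sym inv _ \<open>k \<notin> S\<close>])
    then obtain w where w: "bilin G w w = 1" "\<forall>i\<in>S. bilin G (v i) w = 0"
      by (elim exE conjE)
    have "bilin G w (v i) = 0" if "i \<in> S" for i
      using w(2) that by (subst bilin_commute[OF sym]) blast
    then show ?case
      using w \<open>k \<notin> S\<close> by (intro exI[of _ "v(k := w)"] ballI) (auto simp: v)
  qed auto
  from this[of UNIV] obtain v :: "'n \<Rightarrow> complex ^ 'n"
    where v: "\<And>i j. bilin G (v i) (v j) = (if i = j then 1 else 0)"
    by auto
  show ?thesis
  proof
    have col: "column i (\<chi> r c. v c $ r) = v i" for i
      by (simp add: column_def vec_eq_iff)
    show "transpose (\<chi> r c. v c $ r) ** G ** (\<chi> r c. v c $ r) = mat 1"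
      by (simp add: vec_eq_iff bilin_columns col v mat_def)
  qed
qed

text \<open>An orthonormal basis \<open>P\<close> for \<open>G\<close> exhibits \<open>G\<close> as
  the congruence of the identity by \<open>matrix_inv P\<close>, and this inverse serves as
  \<open>C\<close>.\<close>

lemma symmetric_factorization:
  fixes G :: "complex ^ 'n ^ 'n"
  assumes sym: "transpose G = G" and inv: "invertible G"
  obtains C :: "complex ^ 'n ^ 'n" where "invertible C" "G = transpose C ** C"
proof -
  obtain P :: "complex ^ 'n ^ 'n" where P: "transpose P ** G ** P = mat 1"
    using orthonormal_basis_exists[OF assms] .
  then have "invertible P"
    unfolding invertible_left_inverse by blast
  then have iP: "P ** matrix_inv P = mat 1" "matrix_inv P ** P = mat 1"
    by (rule matrix_inv_cancel)+
  then have tP: "transpose (matrix_inv P) ** transpose P = mat 1"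
    by (metis matrix_transpose_mul transpose_mat)
  have "transpose (matrix_inv P) ** (transpose P ** G ** P) ** matrix_inv P = G"
    by (metis iP(1) tP matrix_mul_assoc matrix_mul_lid matrix_mul_rid)
  then have "G = transpose (matrix_inv P) ** matrix_inv P"
    by (simp add: P)
  moreover have "invertible (matrix_inv P)"
    using iP invertible_def by blast
  ultimately show ?thesis
    using that by blast
qed

section \<open>Conjugation and irreducibility\<close>

lemma SL_normalize:
  fixes C :: "complex ^ 'n ^ 'n"
  assumes "invertible C"
  obtains k where "mat k ** C \<in> SL"
proof -
  have n: "CARD('n) > 0"
    by simp
  \<comment> \<open>The logarithm supplies a \<open>CARD('n)\<close>-th root of
    \<open>inverse (det C)\<close>.\<close>
  define k where "k = exp (- Ln (det C) / of_nat CARD('n))"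
  have "k ^ CARD('n) = exp (- Ln (det C))"
    using n by (simp add: k_def flip: exp_of_nat_mult)
  also have "\<dots> = inverse (det C)"
    using assms by (simp add: exp_minus invertible_det_nz)
  finally have "k ^ CARD('n) * det C = 1"
    using assms by (simp add: invertible_det_nz)
  moreover have "det (mat k :: complex ^ 'n ^ 'n) = k ^ CARD('n)"
    by (subst det_diagonal) (auto simp: mat_def)
  ultimately show ?thesis
    by (intro that[of k]) (simp_all add: k_def SL_def det_mul)
qed

text \<open>Irreducibility speaks of all words, inverse letters included. In finite dimension an
  invertible matrix mapping \<open>V\<close> into itself maps it onto itself, so its inverse
  preserves \<open>V\<close> too.\<close>

lemma irreducible_pairD:
  fixes a b :: "'a::field ^ 'n ^ 'n"
  assumes irr: "irreducible_pair a b" and ab: "invertible a" "invertible b"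
    and V: "vec.subspace V" "\<And>v. v \<in> V \<Longrightarrow> a *v v \<in> V" "\<And>v. v \<in> V \<Longrightarrow> b *v v \<in> V"
  shows "V = {0} \<or> V = UNIV"
proof -
  have inv: "matrix_inv m *v v \<in> V"
    if m: "invertible m" and mV: "\<And>v. v \<in> V \<Longrightarrow> m *v v \<in> V" and v: "v \<in> V" for m :: "'a ^ 'n ^ 'n" and v
  proof -
    have inj: "inj ((*v) m)"
      using m invertible_left_inverse matrix_left_invertible_injective by blast
    have sub: "vec.subspace ((*v) m ` V)"
      using vec.linear_subspace_image[OF matrix_vector_mul_linear_gen V(1)] .
    have "vec.dim ((*v) m ` V) = vec.dim V"
      by (rule vec.dim_image_eq[OF matrix_vector_mul_linear_gen]) (use inj in \<open>auto intro: inj_on_subset\<close>)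
    then have "(*v) m ` V = V"
      using vec.subspace_dim_equal[OF sub V(1)] mV by auto
    then obtain u where "u \<in> V" "v = m *v u"
      using v by blast
    then show ?thesis
      using matrix_inv_cancel(2)[OF m] by (simp add: matrix_vector_mul_assoc)
  qed
  have letter: "eval_letter a b x *v v \<in> V" if "v \<in> V" for x v
    using inv[OF ab(1)] inv[OF ab(2)] V that
    by (cases "(a, b, x)" rule: eval_letter.cases) auto
  have "F2_rep a b w *v v \<in> V" if "v \<in> V" for w v
    using that by (induction w) (auto simp: F2_rep_def letter simp flip: matrix_vector_mul_assoc)
  then show ?thesis
    using irr V(1) unfolding irreducible_pair_def irreducible_rep_def by blast
qed

section \<open>Conjugation, transposition and commutator traces\<close>

lemma mat_mult_commute: "mat k ** A = A ** (mat k :: 'a::comm_semiring_1 ^ 'n ^ 'n)"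
  by (simp add: vec_eq_iff matrix_matrix_mult_def mat_def if_distrib if_distribR mult.commute
      cong: if_cong)

lemma matrix_inv_conj:
  fixes a c :: "'a::field ^ 'n ^ 'n"
  assumes "invertible a" "invertible c"
  shows "matrix_inv (c ** a ** matrix_inv c) = c ** matrix_inv a ** matrix_inv c"
proof (rule matrix_inv_eqI)
  have "c ** a ** matrix_inv c ** (c ** matrix_inv a ** matrix_inv c) =
      c ** (a ** (matrix_inv c ** c) ** matrix_inv a) ** matrix_inv c"
    by (simp add: matrix_mul_assoc)
  then show "c ** a ** matrix_inv c ** (c ** matrix_inv a ** matrix_inv c) = mat 1"
    by (simp add: matrix_inv_cancel assms)
qed

lemma conj_mult:
  fixes a b c :: "'a::field ^ 'n ^ 'n"
  assumes "invertible c"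
  shows "c ** a ** matrix_inv c ** (c ** b ** matrix_inv c) = c ** (a ** b) ** matrix_inv c"
proof -
  have "c ** a ** matrix_inv c ** (c ** b ** matrix_inv c) =
      c ** (a ** (matrix_inv c ** c) ** b) ** matrix_inv c"
    by (simp add: matrix_mul_assoc)
  then show ?thesis
    by (simp add: matrix_inv_cancel assms)
qed

lemma trace_conj:
  fixes a c :: "'a::field ^ 'n ^ 'n"
  assumes "invertible c"
  shows "trace (c ** a ** matrix_inv c) = trace a"
proof -
  have "trace (c ** a ** matrix_inv c) = trace (matrix_inv c ** c ** a)"
    by (subst trace_mul_sym) (simp add: matrix_mul_assoc)
  then show ?thesis
    by (simp add: matrix_inv_cancel assms)
qed

text \<open>Makes the trace condition independent of the basis, so it can be tested in adapted
  coordinates.\<close>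

lemma trace_commutator_conj:
  fixes a b c :: "'a::field ^ 'n ^ 'n"
  assumes "invertible a" "invertible b" "invertible c"
  defines "A \<equiv> c ** a ** matrix_inv c" and "B \<equiv> c ** b ** matrix_inv c"
  shows "trace (A ** B ** matrix_inv A ** matrix_inv B) = trace (a ** b ** matrix_inv a ** matrix_inv b)"
  unfolding A_def B_def by (simp add: matrix_inv_conj conj_mult trace_conj assms)

lemma invertible_SL: "A \<in> SL \<Longrightarrow> invertible (A :: 'a::field ^ 'n ^ 'n)"
  by (simp add: SL_def invertible_det_nz)

lemma SL_conj:
  fixes a c :: "'a::field ^ 'n ^ 'n"
  assumes "a \<in> SL" "invertible c"
  shows "c ** a ** matrix_inv c \<in> SL"
proof -
  have "det c * det (matrix_inv c) = 1"
    using matrix_inv_cancel(1)[OF assms(2)] by (metis det_mul det_I)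
  then show ?thesis
    using assms(1) by (simp add: SL_def det_mul)
qed

text \<open>Transposing reverses the word and fixes each letter; a cyclic rotation under the trace
  then gives the opposite commutator.\<close>

lemma trace_commutator_symmetric:
  fixes A B :: "'a::field ^ 'n ^ 'n"
  assumes sym: "transpose A = A" "transpose B = B" and inv: "invertible A" "invertible B"
  shows "trace (A ** B ** matrix_inv A ** matrix_inv B) = trace (B ** A ** matrix_inv B ** matrix_inv A)"
proof -
  have inv_sym: "transpose (matrix_inv M) = matrix_inv M"
    if "transpose M = M" "invertible M" for M :: "'a ^ 'n ^ 'n"
  proof (rule matrix_inv_eqI[symmetric])
    show "M ** transpose (matrix_inv M) = mat 1"
      by (metis that matrix_inv_cancel(2) matrix_transpose_mul transpose_mat)
  qed
  have "trace (A ** B ** matrix_inv A ** matrix_inv B) =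
      trace (transpose (A ** B ** matrix_inv A ** matrix_inv B))"
    by (simp add: trace_def transpose_def)
  also have "\<dots> = trace (matrix_inv B ** matrix_inv A ** (B ** A))"
    by (simp add: matrix_transpose_mul sym inv inv_sym matrix_mul_assoc)
  also have "\<dots> = trace (B ** A ** matrix_inv B ** matrix_inv A)"
    by (subst trace_mul_sym) (simp add: matrix_mul_assoc)
  finally show ?thesis .
qed

lemma transpose_congruence:
  fixes M :: "'a::comm_semiring_1 ^ 'n ^ 'n"
  assumes "transpose M = M"
  shows "transpose (transpose Q ** M ** Q) = transpose Q ** M ** Q"
  by (simp only: matrix_transpose_mul transpose_transpose assms matrix_mul_assoc)

section \<open>Symmetrizing matrices\<close>

text \<open>Self-adjointness of \<open>A\<close> and \<open>B\<close> for the symmetric bilinear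
  form with Gram matrix \<open>G\<close>.\<close>

definition symmetrizes :: "'a::semiring_1 ^ 'n ^ 'n \<Rightarrow> 'a ^ 'n ^ 'n \<Rightarrow> 'a ^ 'n ^ 'n \<Rightarrow> bool" where
  "symmetrizes G A B \<longleftrightarrow> transpose G = G \<and> transpose (G ** A) = G ** A \<and> transpose (G ** B) = G ** B"

lemma symmetrizes_3:
  fixes G :: "'a::semiring_1 ^ 3 ^ 3"
  shows "symmetrizes G A B \<longleftrightarrow>
     G$1$2 = G$2$1 \<and> G$1$3 = G$3$1 \<and> G$2$3 = G$3$2 \<and>
     (G ** A)$1$2 = (G ** A)$2$1 \<and> (G ** A)$1$3 = (G ** A)$3$1 \<and> (G ** A)$2$3 = (G ** A)$3$2 \<and>
     (G ** B)$1$2 = (G ** B)$2$1 \<and> (G ** B)$1$3 = (G ** B)$3$1 \<and> (G ** B)$2$3 = (G ** B)$3$2"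
  unfolding symmetrizes_def by (auto simp: vec_eq_iff forall_3 transpose_def)

lemma mult3_nth:
  fixes A :: "'a::semiring_1 ^ 3 ^ 3"
  shows "(A ** B)$i$j = A$i$1 * B$1$j + A$i$2 * B$2$j + A$i$3 * B$3$j"
  by (simp add: matrix_matrix_mult_def sum_3)

text \<open>The shape of the pair in the basis \<open>v, b v, b (b v)\<close>: \<open>B\<close> is a
  companion matrix and the first basis vector is an eigenvector of \<open>A\<close>. Symmetry of
  \<open>G\<close> and \<open>G ** B\<close> leaves three parameters, on which symmetry of
  \<open>G ** A\<close> imposes three linear conditions.\<close>

lemma symmetrizer_companion:
  fixes A B :: "'a::field ^ 3 ^ 3"
  assumes A: "A$2$1 = 0" "A$3$1 = 0"
    and B: "B$1$1 = 0" "B$2$1 = 1" "B$3$1 = 0" "B$1$2 = 0" "B$2$2 = 0" "B$3$2 = 1"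
    and tr: "trace (A ** B ** adjugate3 A ** adjugate3 B) =
      trace (B ** A ** adjugate3 B ** adjugate3 A)"
  obtains G where "G \<noteq> 0" "symmetrizes G A B"
proof -
  define l a12 a13 a22 a23 a32 a33 p q r where defs: "l = A$1$1" "a12 = A$1$2" "a13 = A$1$3"
    "a22 = A$2$2" "a23 = A$2$3" "a32 = A$3$2" "a33 = A$3$3" "p = B$1$3" "q = B$2$3" "r = B$3$3"
  note entries = A B defs[symmetric]
  \<comment> \<open>\<open>H x y z\<close> is the general symmetric (Hankel) matrix for which \<open>H x y z ** B\<close> is symmetric.\<close>
  define H where "H x y z = (let h3 = p * x + q * y + r * z; h4 = p * y + q * z + r * h3 in
    (vector [vector [x, y, z], vector [y, z, h3], vector [z, h3, h4]] :: 'a ^ 3 ^ 3))" for x y z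
  have H_sym: "symmetrizes (H x y z) A B \<longleftrightarrow>
     (H x y z ** A)$1$2 = (H x y z ** A)$2$1 \<and> (H x y z ** A)$1$3 = (H x y z ** A)$3$1 \<and>
     (H x y z ** A)$2$3 = (H x y z ** A)$3$2" for x y z
    by (simp add: symmetrizes_3 H_def Let_def mult3_nth entries algebra_simps)
  define d where "d x y z = (vector [(H x y z ** A)$1$2 - (H x y z ** A)$2$1,
     (H x y z ** A)$1$3 - (H x y z ** A)$3$1, (H x y z ** A)$2$3 - (H x y z ** A)$3$2] :: 'a^3)" for x y z
  define M :: "'a ^ 3 ^ 3"
    where "M = (\<chi> i j. (if j = 1 then d 1 0 0 else if j = 2 then d 0 1 0 else d 0 0 1) $ i)"
  have d: "M *v v = d (v$1) (v$2) (v$3)" for v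
    by (simp add: vec_eq_iff forall_3 M_def matrix_vector_mult_def sum_3 d_def mult3_nth H_def
        Let_def entries algebra_simps)
  \<comment> \<open>A polynomial identity in the remaining entries; it turns the trace hypothesis
    into singularity of the linear system.\<close>
  have "det M = trace (B ** A ** adjugate3 B ** adjugate3 A) - trace (A ** B ** adjugate3 A ** adjugate3 B)"
    by (simp add: det_3 M_def d_def mult3_nth H_def Let_def entries trace_def sum_3 adjugate3_def)
      algebra
  then have "det M = 0"
    using tr by simp
  then obtain v where v: "v \<noteq> 0" "M *v v = 0"
    by (rule singular_kernel)
  show ?thesis
  proof
    \<comment> \<open>The first row of this matrix is \<open>v\<close> itself.\<close>
    show "H (v$1) (v$2) (v$3) \<noteq> 0"
      using v(1) by (auto simp: vec_eq_iff forall_3 H_def Let_def)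
    show "symmetrizes (H (v$1) (v$2) (v$3)) A B"
      using v(2) unfolding d H_sym by (simp add: d_def vec_eq_iff forall_3)
  qed
qed

text \<open>The shape in the basis \<open>v, b v, a (b v)\<close> when \<open>b\<close> preserves
  the plane of the first two vectors. The (1,2) and (2,3) conditions for \<open>A\<close> fix the
  entries (1,3) and (3,3) of \<open>G\<close>, and the (1,2) and (1,3) conditions for
  \<open>B\<close> fix (2,2) and (2,3).\<close>

lemma symmetrizer_plane:
  fixes A B :: "'a::field ^ 3 ^ 3"
  assumes A: "A$2$1 = 0" "A$3$1 = 0" "A$1$2 = 0" "A$2$2 = 0" "A$3$2 = 1"
    and B: "B$1$1 = 0" "B$2$1 = 1" "B$3$1 = 0" "B$3$2 = 0"
    and tr: "trace (A ** B ** adjugate3 A ** adjugate3 B) =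
      trace (B ** A ** adjugate3 B ** adjugate3 A)"
  obtains G where "G \<noteq> 0" "symmetrizes G A B"
proof -
  define l a13 a23 a33 p q r s t where defs: "l = A$1$1" "a13 = A$1$3"
    "a23 = A$2$3" "a33 = A$3$3" "p = B$1$2" "q = B$2$2" "r = B$1$3" "s = B$2$3" "t = B$3$3"
  note entries = A B defs[symmetric]
  \<comment> \<open>\<open>H x y\<close> solves four of the six symmetry conditions; \<open>d\<close> holds the other two.\<close>
  define H where "H x y = (let z = l * y; u = p * x + q * y; w = r * x + s * y + t * z in
    (vector [vector [x, y, z], vector [y, u, w], vector [z, w, a13 * y + a23 * u + a33 * w]] :: 'a ^ 3 ^ 3))"
    for x y
  have H_sym: "symmetrizes (H x y) A B \<longleftrightarrow>
     (H x y ** A)$1$3 = (H x y ** A)$3$1 \<and> (H x y ** B)$2$3 = (H x y ** B)$3$2" for x y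
    by (simp add: symmetrizes_3 H_def Let_def mult3_nth entries algebra_simps)
  define d where "d x y = (vector [(H x y ** A)$1$3 - (H x y ** A)$3$1,
     (H x y ** B)$2$3 - (H x y ** B)$3$2] :: 'a^2)" for x y
  define M :: "'a ^ 2 ^ 2" where "M = (\<chi> i j. (if j = 1 then d 1 0 else d 0 1) $ i)"
  have d: "M *v v = d (v$1) (v$2)" for v
    by (simp add: vec_eq_iff forall_2 M_def matrix_vector_mult_def sum_2 d_def mult3_nth H_def
        Let_def entries algebra_simps)
  \<comment> \<open>The sign is opposite to that in the companion case; only vanishing
    matters.\<close>
  have "det M = trace (A ** B ** adjugate3 A ** adjugate3 B) - trace (B ** A ** adjugate3 B ** adjugate3 A)"
    by (simp add: det_2 M_def d_def mult3_nth H_def Let_def entries trace_def sum_3 adjugate3_def)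
      algebra
  then have "det M = 0"
    using tr by simp
  then obtain v where v: "v \<noteq> 0" "M *v v = 0"
    by (rule singular_kernel)
  show ?thesis
  proof
    show "H (v$1) (v$2) \<noteq> 0"
      using v(1) by (auto simp: vec_eq_iff forall_3 forall_2 H_def Let_def)
    show "symmetrizes (H (v$1) (v$2)) A B"
      using v(2) unfolding d H_sym by (simp add: d_def vec_eq_iff forall_2)
  qed
qed

section \<open>Transport and nondegeneracy of symmetrizing forms\<close>

lemma symmetrizes_congruence:
  fixes a b Q :: "'a::comm_semiring_1 ^ 'n ^ 'n"
  assumes G: "symmetrizes G A B" and a: "Q ** a = A ** Q" and b: "Q ** b = B ** Q"
  shows "symmetrizes (transpose Q ** G ** Q) a b"
proof -
  have assoc: "transpose Q ** G ** Q ** a = transpose Q ** (G ** A) ** Q"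
    "transpose Q ** G ** Q ** b = transpose Q ** (G ** B) ** Q"
    by (simp_all add: a b flip: matrix_mul_assoc)
  show ?thesis
    using G unfolding symmetrizes_def assoc by (simp add: transpose_congruence)
qed

text \<open>The conjugate of \<open>a\<close> is the congruence of
  \<open>transpose c ** c ** a\<close> by \<open>matrix_inv c\<close>, and congruence preserves
  symmetry.\<close>

lemma symmetric_conj:
  fixes a c :: "'a::field ^ 'n ^ 'n"
  assumes c: "invertible c" and sym: "transpose (transpose c ** c ** a) = transpose c ** c ** a"
  shows "transpose (c ** a ** matrix_inv c) = c ** a ** matrix_inv c"
proof -
  let ?d = "matrix_inv c"
  have "transpose ?d ** transpose c = mat 1"
    by (metis c matrix_inv_cancel(1) matrix_transpose_mul transpose_mat)
  then have *: "c ** a ** ?d = transpose ?d ** (transpose c ** c ** a) ** ?d"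
    by (metis matrix_mul_assoc matrix_mul_lid)
  show ?thesis
    unfolding * by (rule transpose_congruence[OF sym])
qed

text \<open>Self-adjointness reads \<open>G ** m = transpose m ** G\<close>, so \<open>m\<close>
  preserves the kernel of \<open>G\<close>.\<close>

lemma symmetrizer_invertible:
  fixes a b G :: "'a::field ^ 'n ^ 'n"
  assumes irr: "irreducible_pair a b" and ab: "invertible a" "invertible b"
    and G: "symmetrizes G a b" "G \<noteq> 0"
  shows "invertible G"
proof -
  define V where "V = {x. G *v x = 0}"
  have "vec.subspace V"
    unfolding V_def by (rule vec.subspaceI) (simp_all add: matrix_vector_right_distrib vector_scalar_commute)
  moreover have "m *v x \<in> V" if "transpose (G ** m) = G ** m" "x \<in> V" for m x
  proof -
    have "G ** m = transpose m ** G"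
      using that(1) G(1) by (metis matrix_transpose_mul symmetrizes_def)
    then have "G *v (m *v x) = transpose m *v (G *v x)"
      by (metis matrix_vector_mul_assoc)
    then show ?thesis
      using that(2) by (simp add: V_def)
  qed
  ultimately have "V = {0} \<or> V = UNIV"
    using G(1) unfolding symmetrizes_def by (intro irreducible_pairD[OF irr ab]) blast+
  moreover have "V \<noteq> UNIV"
  proof
    assume "V = UNIV"
    then have "G *v x = 0 *v x" for x
      unfolding V_def by auto
    then show False
      using G(2) by (metis matrix_eq)
  qed
  ultimately show ?thesis
    unfolding invertible_left_inverse matrix_left_invertible_ker V_def by blast
qed

section \<open>Bases adapted to an irreducible pair\<close>

text \<open>\<open>Q\<close> is the inverse of the matrix with columns \<open>u\<close>,
  \<open>v\<close>, \<open>w\<close>; the span hypotheses kill the coefficients of a linear relation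
  from last to first.\<close>

lemma basis_change3:
  fixes u v w :: "'a::field ^ 3"
  assumes u: "u \<noteq> 0" and v: "v \<notin> vec.span {u}" and w: "w \<notin> vec.span {v, u}"
  obtains Q :: "'a ^ 3 ^ 3"
  where "invertible Q" "Q *v u = axis 1 1" "Q *v v = axis 2 1" "Q *v w = axis 3 1"
proof -
  define P :: "'a ^ 3 ^ 3" where "P = (\<chi> i j. (if j = 1 then u else if j = 2 then v else w) $ i)"
  have P: "P *v x = x$1 *s u + x$2 *s v + x$3 *s w" for x
    by (simp add: vec_eq_iff P_def matrix_vector_mult_def sum_3 mult.commute)
  have "x = 0" if "P *v x = 0" for x
  proof -
    have 0: "x$1 *s u + x$2 *s v + x$3 *s w = 0"
      using that P by simp
    have x3: "x$3 = 0"
    proof (rule ccontr)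
      assume "x$3 \<noteq> 0"
      have "x$3 *s w = - (x$1 *s u + x$2 *s v)"
        using 0 by (simp add: add_eq_0_iff)
      moreover have "- (x$1 *s u + x$2 *s v) \<in> vec.span {v, u}"
        by (intro vec.span_neg vec.span_add vec.span_scale vec.span_base) auto
      ultimately have "inverse (x$3) *s (x$3 *s w) \<in> vec.span {v, u}"
        by (simp only: vec.span_scale)
      then show False
        using w \<open>x$3 \<noteq> 0\<close> by simp
    qed
    have x2: "x$2 = 0"
    proof (rule ccontr)
      assume "x$2 \<noteq> 0"
      have "x$2 *s v = - (x$1 *s u)"
        using 0 x3 by (simp add: add_eq_0_iff)
      moreover have "- (x$1 *s u) \<in> vec.span {u}"
        by (intro vec.span_neg vec.span_scale vec.span_base) auto
      ultimately have "inverse (x$2) *s (x$2 *s v) \<in> vec.span {u}"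
        by (simp only: vec.span_scale)
      then show False
        using v \<open>x$2 \<noteq> 0\<close> by simp
    qed
    have "x$1 = 0"
      using 0 x2 x3 u by simp
    then show ?thesis
      using x2 x3 by (simp add: vec_eq_iff forall_3)
  qed
  then have P_inv: "invertible P"
    unfolding invertible_left_inverse matrix_left_invertible_ker by blast
  have cols: "P *v axis 1 1 = u" "P *v axis 2 1 = v" "P *v axis 3 1 = w"
    by (simp_all add: P axis_def)
  show ?thesis
  proof
    show "invertible (matrix_inv P)"
      using matrix_inv_cancel[OF P_inv] unfolding invertible_def by blast
  qed (metis cols matrix_inv_cancel(2)[OF P_inv] matrix_vector_mul_assoc matrix_vector_mul_lid)+
qed

lemma span_invariant:
  fixes m :: "'a::field ^ 'n ^ 'n"
  assumes "\<And>u. u \<in> S \<Longrightarrow> m *v u \<in> vec.span S" and "x \<in> vec.span S"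
  shows "m *v x \<in> vec.span S"
proof -
  have "vec.subspace ((*v) m -` vec.span S)"
    by (rule vec.subspace_vimage[OF vec.subspace_span])
  then have "vec.span S \<subseteq> (*v) m -` vec.span S"
    using assms(1) by (intro vec.span_minimal) auto
  then show ?thesis
    using assms(2) by auto
qed

text \<open>Too few vectors to span the space and one of them nonzero: the span is a proper nonzero
  subspace, which irreducibility forbids to be invariant.\<close>

lemma span_not_invariant:
  fixes a b :: "'a::field ^ 'n ^ 'n"
  assumes irr: "irreducible_pair a b" and ab: "invertible a" "invertible b"
    and S: "finite S" "card S < CARD('n)" and v: "v \<in> S" "v \<noteq> 0"
  shows "\<exists>u\<in>S. a *v u \<notin> vec.span S \<or> b *v u \<notin> vec.span S"
proof (rule ccontr)
  assume "\<not> ?thesis"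
  then have "a *v x \<in> vec.span S" "b *v x \<in> vec.span S" if "x \<in> vec.span S" for x
    using span_invariant[OF _ that] by blast+
  then have "vec.span S = {0} \<or> vec.span S = UNIV"
    using irreducible_pairD[OF irr ab vec.subspace_span] by blast
  moreover have "vec.span S \<noteq> {0}"
    using v vec.span_base by blast
  moreover have "vec.span S \<noteq> UNIV"
  proof
    assume "vec.span S = UNIV"
    then have "vec.dim (UNIV :: ('a ^ 'n) set) \<le> card S"
      using S(1) by (intro vec.dim_le_card) auto
    then show False
      using S(2) by (simp add: card_cart_basis)
  qed
  ultimately show False
    by blast
qed

lemma nth_eq_mult_axis:
  fixes A :: "'a::semiring_1 ^ 'n ^ 'm"
  shows "A$i$j = (A *v axis j 1)$i"
  by (simp add: matrix_vector_mult_def axis_def if_distrib cong: if_cong)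

lemma symmetrizer_exists:
  fixes a b :: "complex ^ 3 ^ 3"
  assumes irr: "irreducible_pair a b" and SL: "a \<in> SL" "b \<in> SL"
    and tr: "trace (a ** b ** matrix_inv a ** matrix_inv b) = trace (b ** a ** matrix_inv b ** matrix_inv a)"
  obtains G where "G \<noteq> 0" "symmetrizes G a b"
proof -
  note inv = SL[THEN invertible_SL]
  obtain l v where v: "v \<noteq> 0" "a *v v = l *s v"
    by (rule eigenvector3_exists)
  define u where "u = b *v v"
  have av: "a *v v \<in> vec.span S" if "v \<in> S" for S
    using that by (simp add: v(2) vec.span_scale vec.span_base)
  have u: "u \<notin> vec.span {v}"
    using span_not_invariant[OF irr inv, of "{v}" v] v(1) av[of "{v}"] by (auto simp: u_def)
  have bv: "b *v v \<in> vec.span {u, v}"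
    by (auto simp: u_def intro: vec.span_base)
  \<comment> \<open>Reduces the claim to the matrices \<open>A\<close>, \<open>B\<close> of the pair
    in \<open>Q\<close>-coordinates, handing over the trace condition and the first columns, which
    both cases share.\<close>
  have transfer: "\<exists>G. G \<noteq> 0 \<and> symmetrizes G a b"
    if Q: "invertible Q" and col: "Q *v v = axis 1 1" "Q *v u = axis 2 1"
      and G: "\<And>A B. (\<And>x. A *v (Q *v x) = Q *v (a *v x)) \<Longrightarrow>
        (\<And>x. B *v (Q *v x) = Q *v (b *v x)) \<Longrightarrow>
        trace (A ** B ** adjugate3 A ** adjugate3 B) = trace (B ** A ** adjugate3 B ** adjugate3 A) \<Longrightarrow>
        A *v axis 1 1 = l *s axis 1 1 \<Longrightarrow> B *v axis 1 1 = axis 2 1 \<Longrightarrow>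
        \<exists>G. G \<noteq> 0 \<and> symmetrizes G A B" for Q :: "complex ^ 3 ^ 3"
  proof -
    define A B where "A = Q ** a ** matrix_inv Q" and "B = Q ** b ** matrix_inv Q"
    have QA: "Q ** a = A ** Q" and QB: "Q ** b = B ** Q"
      by (simp_all add: A_def B_def matrix_inv_cancel[OF Q] flip: matrix_mul_assoc)
    have Ax: "A *v (Q *v x) = Q *v (a *v x)" and Bx: "B *v (Q *v x) = Q *v (b *v x)" for x
      by (simp_all add: matrix_vector_mul_assoc QA QB)
    have "A \<in> SL" "B \<in> SL"
      unfolding A_def B_def using SL Q by (simp_all add: SL_conj)
    then have adj: "adjugate3 A = matrix_inv A" "adjugate3 B = matrix_inv B"
      by (simp_all add: matrix_inv_SL3)
    have "trace (A ** B ** adjugate3 A ** adjugate3 B) = trace (B ** A ** adjugate3 B ** adjugate3 A)"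
      using tr trace_commutator_conj[OF inv Q, folded A_def B_def]
        trace_commutator_conj[OF inv(2,1) Q, folded A_def B_def]
      by (simp add: adj)
    moreover have "A *v axis 1 1 = l *s axis 1 1"
      using Ax[of v] by (simp add: col v(2) vector_scalar_commute)
    moreover have "B *v axis 1 1 = axis 2 1"
      using Bx[of v] by (simp add: col flip: u_def)
    ultimately obtain G where G: "G \<noteq> 0" "symmetrizes G A B"
      using G[OF Ax Bx] by blast
    have iQ: "Q ** matrix_inv Q = mat 1"
      by (rule matrix_inv_cancel(1)[OF Q])
    have "transpose (matrix_inv Q) ** transpose Q = mat 1"
      by (simp add: iQ flip: matrix_transpose_mul)
    \<comment> \<open>Undoing the congruence recovers \<open>G\<close>, so the pulled-back form is
      nonzero.\<close>
    then have "G = transpose (matrix_inv Q) ** transpose Q ** G ** (Q ** matrix_inv Q)"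
      by (simp add: iQ)
    also have "\<dots> = transpose (matrix_inv Q) ** (transpose Q ** G ** Q) ** matrix_inv Q"
      by (simp add: matrix_mul_assoc)
    finally have "G = \<dots>" .
    then have "transpose Q ** G ** Q \<noteq> 0"
      using G(1) by fastforce
    then show ?thesis
      using symmetrizes_congruence[OF G(2) QA QB] by blast
  qed
  have "\<exists>G. G \<noteq> 0 \<and> symmetrizes G a b"
  proof (cases "b *v u \<in> vec.span {u, v}")
    case False
    obtain Q :: "complex ^ 3 ^ 3"
      where Q: "invertible Q" "Q *v v = axis 1 1" "Q *v u = axis 2 1" "Q *v (b *v u) = axis 3 1"
      by (rule basis_change3[OF v(1) u False])
    show ?thesis
    proof (rule transfer[OF Q(1-3)])
      fix A B
      assume Bx: "\<And>x. B *v (Q *v x) = Q *v (b *v x)"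
        and tr: "trace (A ** B ** adjugate3 A ** adjugate3 B) = trace (B ** A ** adjugate3 B ** adjugate3 A)"
        and col: "A *v axis 1 1 = l *s axis 1 1" "B *v axis 1 1 = axis 2 1"
      have "B *v axis 2 1 = axis 3 1"
        using Bx[of u] by (simp add: Q)
      then have "A$2$1 = 0" "A$3$1 = 0" "B$1$1 = 0" "B$2$1 = 1" "B$3$1 = 0" "B$1$2 = 0" "B$2$2 = 0" "B$3$2 = 1"
        using col by (simp_all add: nth_eq_mult_axis) (simp_all add: axis_def)
      from symmetrizer_companion[OF this tr] show "\<exists>G. G \<noteq> 0 \<and> symmetrizes G A B"
        by blast
    qed
  next
    case True
    have "card {u, v} < CARD(3)"
      by (rule le_less_trans[OF card_insert_le_m1]) auto
    \<comment> \<open>The plane contains \<open>a *v v\<close>, \<open>b *v v\<close> and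
      \<open>b *v u\<close>, so only \<open>a *v u\<close> can leave it.\<close>
    then have au: "a *v u \<notin> vec.span {u, v}"
      using span_not_invariant[OF irr inv, of "{u, v}" v] v(1) av[of "{u, v}"] bv True by auto
    obtain Q :: "complex ^ 3 ^ 3"
      where Q: "invertible Q" "Q *v v = axis 1 1" "Q *v u = axis 2 1" "Q *v (a *v u) = axis 3 1"
      by (rule basis_change3[OF v(1) u au])
    \<comment> \<open>In the new coordinates the plane has vanishing third coordinate, which yields
      \<open>B$3$2 = 0\<close>.\<close>
    have "Q *v x \<in> {y. y$3 = 0}" if "x \<in> vec.span {u, v}" for x
    proof -
      have "vec.subspace {y :: complex ^ 3. y$3 = 0}"
        by (rule vec.subspaceI) auto
      then have "vec.subspace ((*v) Q -` {y. y$3 = 0})"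
        by (rule vec.subspace_vimage)
      then have "vec.span {u, v} \<subseteq> (*v) Q -` {y. y$3 = 0}"
        by (intro vec.span_minimal) (auto simp: Q axis_def)
      then show ?thesis
        using that by auto
    qed
    then have bu: "(Q *v (b *v u))$3 = 0"
      using True by simp
    show ?thesis
    proof (rule transfer[OF Q(1-3)])
      fix A B
      assume Ax: "\<And>x. A *v (Q *v x) = Q *v (a *v x)" and Bx: "\<And>x. B *v (Q *v x) = Q *v (b *v x)"
        and tr: "trace (A ** B ** adjugate3 A ** adjugate3 B) = trace (B ** A ** adjugate3 B ** adjugate3 A)"
        and col: "A *v axis 1 1 = l *s axis 1 1" "B *v axis 1 1 = axis 2 1"
      have "A *v axis 2 1 = axis 3 1"
        using Ax[of u] by (simp add: Q)
      moreover have "(B *v axis 2 1)$3 = 0"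
        using Bx[of u] bu by (simp add: Q)
      ultimately have "A$2$1 = 0" "A$3$1 = 0" "A$1$2 = 0" "A$2$2 = 0" "A$3$2 = 1"
        "B$1$1 = 0" "B$2$1 = 1" "B$3$1 = 0" "B$3$2 = 0"
        using col by (simp_all add: nth_eq_mult_axis) (simp_all add: axis_def)
      from symmetrizer_plane[OF this tr] show "\<exists>G. G \<noteq> 0 \<and> symmetrizes G A B"
        by blast
    qed
  qed
  then show thesis
    using that by blast
qed

theorem theorem3p8:
  fixes a b :: "complex ^ 3 ^ 3"
  assumes "a \<in> SL" and "b \<in> SL" and "irreducible_pair a b"
  shows "(\<exists>c \<in> SL.
            transpose (c ** a ** matrix_inv c) = c ** a ** matrix_inv c \<and>
            transpose (c ** b ** matrix_inv c) = c ** b ** matrix_inv c) \<longleftrightarrow>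
         trace (a ** b ** matrix_inv a ** matrix_inv b) =
         trace (b ** a ** matrix_inv b ** matrix_inv a)"
    (is "?sym \<longleftrightarrow> ?tr")
proof
  note inv = assms(1,2)[THEN invertible_SL]
  show ?tr if ?sym
  proof -
    obtain c where c: "c \<in> SL" "transpose (c ** a ** matrix_inv c) = c ** a ** matrix_inv c"
      "transpose (c ** b ** matrix_inv c) = c ** b ** matrix_inv c"
      using \<open>?sym\<close> by blast
    note c_inv = invertible_SL[OF c(1)]
    have "invertible (c ** a ** matrix_inv c)" "invertible (c ** b ** matrix_inv c)"
      using assms c_inv by (auto intro!: invertible_SL SL_conj)
    from trace_commutator_symmetric[OF c(2,3) this] show ?tr
      by (simp add: trace_commutator_conj inv c_inv)
  qed
  show ?sym if ?tr
  proof -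
    obtain G where G: "G \<noteq> 0" "symmetrizes G a b"
      using symmetrizer_exists[OF assms(3,1,2) \<open>?tr\<close>] .
    have "transpose G = G"
      using G(2) by (simp add: symmetrizes_def)
    moreover have "invertible G"
      using symmetrizer_invertible[OF assms(3) inv G(2,1)] .
    ultimately obtain C :: "complex ^ 3 ^ 3" where C: "invertible C" "G = transpose C ** C"
      by (rule symmetric_factorization)
    obtain k where k: "mat k ** C \<in> SL"
      using SL_normalize[OF C(1)] .
    define c where "c = mat k ** C"
    \<comment> \<open>Normalizing the determinant only multiplies \<open>G\<close> by the scalar
      \<open>k * k\<close>, which preserves the symmetry conditions.\<close>
    have "transpose c ** c = mat (k * k) ** G"
    proof -
      have "transpose c ** c = transpose C ** (mat k ** mat k) ** C"
        by (simp add: c_def matrix_transpose_mul matrix_mul_assoc)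
      also have "mat k ** mat k = (mat (k * k) :: complex ^ 3 ^ 3)"
        by (simp add: vec_eq_iff matrix_matrix_mult_def mat_def sum_3 forall_3)
      finally show ?thesis
        by (simp only: C(2) matrix_mul_assoc mat_mult_commute[of "k * k" "transpose C"])
    qed
    then have c_mult: "transpose c ** c ** m = mat (k * k) ** (G ** m)" for m
      by (simp only: matrix_mul_assoc)
    have "transpose (transpose c ** c ** m) = transpose c ** c ** m" if "transpose (G ** m) = G ** m" for m
      unfolding c_mult matrix_transpose_mul[of "mat (k * k)"] that transpose_mat
      by (rule mat_mult_commute[symmetric])
    then show ?sym
      using G(2) k invertible_SL[OF k] symmetric_conj[of c]
      unfolding symmetrizes_def c_def[symmetric] by blast
  qed
qed

end
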